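(* There is a universal constant $C>0$ such that the following holds. Let $g:\mathbb{R}^p\times\mathbb{R}^k\to\mathbb{R}$ be twice continuously differentiable, let $B_\theta>0$, and let $$\mathcal{V}=\{V_\theta(\cdot)=g(\cdot,\theta):\theta\in\mathbb{R}^k,\ \|\theta\|\le B_\theta\}.$$ Assume there is a compact set $S\subseteq\mathbb{R}^p$ such that $\varphi_t(\xi)\in S$ for all $\xi\in X$, $t\in T$. Let $\gamma>0$, $\delta\in(0,1)$, and let $\xi_1,\dots,\xi_n$ be i.i.d. samples from $\mathcal{D}$. If the problem of finding $V\in\mathcal{V}$ such that $$h\left(\varphi_t(\xi_i),\dot\varphi_t(\xi_i),V(\varphi_t(\xi_i)),\tfrac{\partial V}{\partial x}(\varphi_t(\xi_i))\right)\le-\gamma,\qquad i=1,\dots,n,\ t\in T,$$ is feasible, then any solution $\hat V_n\in\mathcal{V}$ satisfies, with probability at least $1-\delta$ over $\xi_1,\dots,\xi_n$, $$\mathsf{err}(\hat V_n)\le C\left(B_\theta^2(L_g+L_{\nabla g})^2L_h^2\,\frac{k\log^3 n}{\gamma^2 n}+\frac{\log(\log(4B_h/\gamma)/\delta)}{n}\right),$$ where $L_g:=\sup_{x\in S,\|\theta\|\le B_\theta}\|\nabla_\theta g(x,\theta)\|$ and $L_{\nabla g}:=\sup_{x\in S,\|\theta\|\le B_\theta}\left\|\frac{\partial^2 g}{\partial\theta\,\partial x}(x,\theta)\right\|$.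
   Context: Setting. The dynamical system is $\dot x=f(x)$ with $f:\mathbb{R}^p\to\mathbb{R}^p$ continuous. $X\subseteq\mathbb{R}^p$ is compact, and $T\subseteq\mathbb{R}_+$ is the maximal interval starting at zero on which a unique solution $\varphi_t(\xi)$ with initial condition $\varphi_0(\xi)=\xi$ exists for all $\xi\in X$, $t\in T$. $\mathcal{D}$ is a probability distribution on $X$. $\dot\varphi_t(\xi)$ is the time derivative of $t\mapsto\varphi_t(\xi)$. $h:\mathbb{R}^p\times\mathbb{R}^p\times\mathbb{R}\times\mathbb{R}^{p}\to\mathbb{R}$ is a fixed known continuous function (certificates are scalar-valued, $V:\mathbb{R}^p\to\mathbb{R}$, continuously differentiable). Generalization error: for $V\in\mathcal{V}$, $$\mathsf{err}(V):=\mathbb{P}_{\xi\sim\mathcal{D}}\left\{\max_{t\in T}h\left(\varphi_t(\xi),\dot\varphi_t(\xi),V(\varphi_t(\xi)),\tfrac{\partial V}{\partial x}(\varphi_t(\xi))\right)>0\right\}$$ (the max understood as a supremum if not attained); the probability is over a fresh $\xi$, with $V$ fixed. Constants: $B_V,B_{\nabla V}$ are finite constants with $\sup_{V\in\mathcal{V}}\sup_{x\in S}|V(x)|\le B_V$ and $\sup_{V\in\mathcal{V}}\sup_{x\in S}\|\frac{\partial V}{\partial x}(x)\|\le B_{\nabla V}$ (these exist for the class in the claim). $B_h$ is a (finite) upper bound on $|h(x,f(x),v,w)|$ over $x\in S$, $|v|\le B_V$, $\|w\|\le B_{\nabla V}$; $L_h$ is a (finite) upper bound, valid for all $x\in S$,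 on the Lipschitz constant of $(v,w)\mapsto h(x,f(x),v,w)$ over $|v|\le B_V$, $\|w\|\le B_{\nabla V}$. $\|\cdot\|$ is the Euclidean norm for vectors and the operator norm for matrices. *)

theory Defs
  imports "HOL-Probability.Probability"
begin

text \<open>
  The universal constant must not depend on the dimensions, so these have to be quantified inside
  the formula and cannot be index types. The space of real \<open>p\<close>-vectors is therefore the set
  \<open>Rn p\<close> of sequences vanishing from index \<open>p\<close> on. The product topology of
  \<^typ>\<open>nat \<Rightarrow> real\<close>, and hence its Borel sigma-algebra, induces the Euclidean one on \<open>Rn p\<close>.
\<close>

definition Rn :: "nat \<Rightarrow> (nat \<Rightarrow> real) set" where
  "Rn p = {x. \<forall>i\<ge>p. x i = 0}"

definition enorm :: "nat \<Rightarrow> (nat \<Rightarrow> real) \<Rightarrow> real" where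
  "enorm p x = L2_set x {..<p}"

definition cball_Rn :: "nat \<Rightarrow> real \<Rightarrow> (nat \<Rightarrow> real) set" where
  "cball_Rn p r = {x \<in> Rn p. enorm p x \<le> r}"

definition opnorm :: "nat \<Rightarrow> nat \<Rightarrow> (nat \<Rightarrow> nat \<Rightarrow> real) \<Rightarrow> real" where
  "opnorm m n A = (SUP v\<in>cball_Rn n 1. enorm m (\<lambda>i. \<Sum>j<n. A i j * v j))"

definition partial :: "nat \<Rightarrow> ((nat \<Rightarrow> real) \<Rightarrow> real) \<Rightarrow> (nat \<Rightarrow> real) \<Rightarrow> real" where
  "partial i F x = deriv (\<lambda>s. F (x(i := s))) (x i)"

definition grad :: "nat \<Rightarrow> ((nat \<Rightarrow> real) \<Rightarrow> real) \<Rightarrow> (nat \<Rightarrow> real) \<Rightarrow> nat \<Rightarrow> real" where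
  "grad p F x = (\<lambda>i. if i < p then partial i F x else 0)"

text \<open>
  Continuous differentiability on \<open>Rn p \<times> Rn k\<close>: all partial derivatives exist and are jointly
  continuous.
\<close>

definition C1 :: "nat \<Rightarrow> nat \<Rightarrow> ((nat \<Rightarrow> real) \<Rightarrow> (nat \<Rightarrow> real) \<Rightarrow> real) \<Rightarrow> bool" where
  "C1 p k g \<longleftrightarrow>
     (\<forall>i<p. (\<forall>x\<in>Rn p. \<forall>\<theta>\<in>Rn k. (\<lambda>s. g (x(i := s)) \<theta>) field_differentiable at (x i)) \<and>
            continuous_on (Rn p \<times> Rn k) (\<lambda>(x, \<theta>). partial i (\<lambda>y. g y \<theta>) x)) \<and>
     (\<forall>j<k. (\<forall>x\<in>Rn p. \<forall>\<theta>\<in>Rn k. (\<lambda>s. g x (\<theta>(j := s))) field_differentiable at (\<theta> j)) \<and>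
            continuous_on (Rn p \<times> Rn k) (\<lambda>(x, \<theta>). partial j (g x) \<theta>))"

definition C2 :: "nat \<Rightarrow> nat \<Rightarrow> ((nat \<Rightarrow> real) \<Rightarrow> (nat \<Rightarrow> real) \<Rightarrow> real) \<Rightarrow> bool" where
  "C2 p k g \<longleftrightarrow> C1 p k g \<and>
     (\<forall>i<p. C1 p k (\<lambda>x \<theta>. partial i (\<lambda>y. g y \<theta>) x)) \<and>
     (\<forall>j<k. C1 p k (\<lambda>x \<theta>. partial j (g x) \<theta>))"

text \<open>The Jacobian with respect to \<open>\<theta>\<close> of the gradient in \<open>x\<close>; \<open>i\<close> is the row index.\<close>

definition mixed_hessian ::
  "((nat \<Rightarrow> real) \<Rightarrow> (nat \<Rightarrow> real) \<Rightarrow> real) \<Rightarrow> (nat \<Rightarrow> real) \<Rightarrow> (nat \<Rightarrow> real) \<Rightarrow> nat \<Rightarrow> nat \<Rightarrow> real" where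
  "mixed_hessian g x \<theta> i j = partial j (\<lambda>\<theta>'. partial i (\<lambda>y. g y \<theta>') x) \<theta>"

text \<open>
  The velocity \<open>x'\<close> is carried along explicitly: on the degenerate interval \<open>{0}\<close> the derivative
  of \<open>x\<close> within the interval is not unique, and only the equation determines \<open>x'\<close>.
\<close>

definition ode_solution ::
  "nat \<Rightarrow> ((nat \<Rightarrow> real) \<Rightarrow> nat \<Rightarrow> real) \<Rightarrow> (nat \<Rightarrow> real) \<Rightarrow> real set \<Rightarrow>
     (real \<Rightarrow> nat \<Rightarrow> real) \<Rightarrow> (real \<Rightarrow> nat \<Rightarrow> real) \<Rightarrow> bool" where
  "ode_solution p f \<xi> I x x' \<longleftrightarrow> x 0 = \<xi> \<and>
     (\<forall>t\<in>I. x t \<in> Rn p \<and> x' t = f (x t) \<and>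
        (\<forall>i<p. ((\<lambda>s. x s i) has_real_derivative x' t i) (at t within I)))"

definition unique_solution ::
  "nat \<Rightarrow> ((nat \<Rightarrow> real) \<Rightarrow> nat \<Rightarrow> real) \<Rightarrow> (nat \<Rightarrow> real) \<Rightarrow> real set \<Rightarrow> bool" where
  "unique_solution p f \<xi> I \<longleftrightarrow>
     (\<exists>x x'. ode_solution p f \<xi> I x x') \<and>
     (\<forall>x x' y y'. ode_solution p f \<xi> I x x' \<longrightarrow> ode_solution p f \<xi> I y y' \<longrightarrow> (\<forall>t\<in>I. x t = y t))"

text \<open>
  Uniqueness is required on every \<open>{0..t}\<close> with \<open>t\<close> in the interval. Uniqueness on the whole
  interval alone would tolerate a second solution that leaves the first one and blows up earlier.
\<close>

definition flow_interval ::
  "nat \<Rightarrow> ((nat \<Rightarrow> real) \<Rightarrow> nat \<Rightarrow> real) \<Rightarrow> (nat \<Rightarrow> real) set \<Rightarrow> real set \<Rightarrow> bool" where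
  "flow_interval p f X I \<longleftrightarrow> is_interval I \<and> 0 \<in> I \<and> I \<subseteq> {0..} \<and>
     (\<forall>\<xi>\<in>X. \<forall>t\<in>I. unique_solution p f \<xi> {0..t})"

definition maximal_flow_interval ::
  "nat \<Rightarrow> ((nat \<Rightarrow> real) \<Rightarrow> nat \<Rightarrow> real) \<Rightarrow> (nat \<Rightarrow> real) set \<Rightarrow> real set \<Rightarrow> bool" where
  "maximal_flow_interval p f X T \<longleftrightarrow>
     flow_interval p f X T \<and> (\<forall>I. flow_interval p f X I \<longrightarrow> I \<subseteq> T)"

definition h_along ::
  "nat \<Rightarrow> ((nat \<Rightarrow> real) \<times> (nat \<Rightarrow> real) \<times> real \<times> (nat \<Rightarrow> real) \<Rightarrow> real) \<Rightarrow>
     (real \<Rightarrow> (nat \<Rightarrow> real) \<Rightarrow> nat \<Rightarrow> real) \<Rightarrow> (real \<Rightarrow> (nat \<Rightarrow> real) \<Rightarrow> nat \<Rightarrow> real) \<Rightarrow>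
     ((nat \<Rightarrow> real) \<Rightarrow> real) \<Rightarrow> real \<Rightarrow> (nat \<Rightarrow> real) \<Rightarrow> real" where
  "h_along p h \<phi> \<phi>' V t \<xi> = h (\<phi> t \<xi>, \<phi>' t \<xi>, V (\<phi> t \<xi>), grad p V (\<phi> t \<xi>))"

definition err ::
  "nat \<Rightarrow> ((nat \<Rightarrow> real) \<times> (nat \<Rightarrow> real) \<times> real \<times> (nat \<Rightarrow> real) \<Rightarrow> real) \<Rightarrow>
     (real \<Rightarrow> (nat \<Rightarrow> real) \<Rightarrow> nat \<Rightarrow> real) \<Rightarrow> (real \<Rightarrow> (nat \<Rightarrow> real) \<Rightarrow> nat \<Rightarrow> real) \<Rightarrow>
     real set \<Rightarrow> (nat \<Rightarrow> real) measure \<Rightarrow> ((nat \<Rightarrow> real) \<Rightarrow> real) \<Rightarrow> real" where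
  "err p h \<phi> \<phi>' T D V =
     measure D {\<xi> \<in> space D. (SUP t\<in>T. ereal (h_along p h \<phi> \<phi>' V t \<xi>)) > 0}"

definition cert_class ::
  "nat \<Rightarrow> ((nat \<Rightarrow> real) \<Rightarrow> (nat \<Rightarrow> real) \<Rightarrow> real) \<Rightarrow> real \<Rightarrow> ((nat \<Rightarrow> real) \<Rightarrow> real) set" where
  "cert_class k g B = (\<lambda>\<theta> x. g x \<theta>) ` cball_Rn k B"

definition Lg ::
  "nat \<Rightarrow> ((nat \<Rightarrow> real) \<Rightarrow> (nat \<Rightarrow> real) \<Rightarrow> real) \<Rightarrow> (nat \<Rightarrow> real) set \<Rightarrow> real \<Rightarrow> real" where
  "Lg k g S B = (SUP (x, \<theta>)\<in>S \<times> cball_Rn k B. enorm k (grad k (g x) \<theta>))"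

definition Lgradg ::
  "nat \<Rightarrow> nat \<Rightarrow> ((nat \<Rightarrow> real) \<Rightarrow> (nat \<Rightarrow> real) \<Rightarrow> real) \<Rightarrow> (nat \<Rightarrow> real) set \<Rightarrow> real \<Rightarrow> real" where
  "Lgradg p k g S B = (SUP (x, \<theta>)\<in>S \<times> cball_Rn k B. opnorm p k (mixed_hessian g x \<theta>))"

end

theory Submission imports Defs begin

text \<open>
  Moving \<open>\<theta>\<close> by at most \<open>\<gamma> / (L\<^sub>h (L\<^sub>g + L\<^sub>\<nabla>\<^sub>g))\<close> changes \<open>h\<close> along every trajectory by at most \<open>\<gamma>\<close>, so a
  certificate that has margin \<open>\<gamma>\<close> on the sample forces every certificate in the same small cell of
  the parameter ball to be valid on the sample. If the cell contains a certificate of error above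
  \<open>\<epsilon>\<close>, this has probability at most \<open>(1 - \<epsilon>)\<^sup>n \<le> exp (- \<epsilon> n)\<close>, and a union bound over the \<open>N\<close> cells
  gives an error of order \<open>(ln N + ln (1 / \<delta>)) / n\<close>.

  Let \<open>R = B\<^sub>\<theta> L\<^sub>h (L\<^sub>g + L\<^sub>\<nabla>\<^sub>g) / \<gamma>\<close>. For \<open>R \<le> 1 / 2\<close> one cell suffices. Otherwise a cubic grid has
  \<open>ln N \<le> k ln (6 R \<surd>k)\<close>; its \<open>ln k\<close> is harmless, because the claimed bound exceeds 1 unless \<open>k\<close> is at
  most of order \<open>n\<close>.
\<close>

section \<open>Topology of the sequence model of Euclidean space\<close>

lemma fun_upd_in_Rn: "\<theta> \<in> Rn k \<Longrightarrow> j < k \<Longrightarrow> \<theta>(j := u) \<in> Rn k"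
  by (auto simp: Rn_def)

lemma tendsto_fun_componentwise:
  fixes f :: "'a \<Rightarrow> nat \<Rightarrow> real"
  assumes "\<And>i. ((\<lambda>x. f x i) \<longlongrightarrow> l i) F"
  shows "(f \<longlongrightarrow> l) F"
  using assms limitin_componentwise[of "\<lambda>_::nat. euclidean :: real topology" UNIV f l F]
  by (simp add: euclidean_product_topology)

text \<open>The ball is closed and sits in the cube of all sequences with entries in
  \<open>{-B..B}\<close>, which is compact by Tychonoff. This compactness later makes the suprema
  \<open>Lg\<close> and \<open>Lgradg\<close> finite.\<close>

lemma compact_cball_Rn: "compact (cball_Rn k B)"
proof -
  have "compactin (product_topology (\<lambda>_::nat. euclidean :: real topology) UNIV) (PiE UNIV (\<lambda>_. {-B..B}))"
    by (simp add: compactin_PiE)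
  then have K: "compact (PiE UNIV (\<lambda>_::nat. {-B..B}))"
    by (simp add: euclidean_product_topology)
  have cont: "continuous_on UNIV (enorm k)"
    unfolding enorm_def L2_set_def
    by (intro continuous_intros continuous_on_product_then_coordinatewise continuous_on_id)
  have closed: "closed (cball_Rn k B)"
  proof -
    have "cball_Rn k B = (\<Inter>i\<in>{k..}. {x. x i = 0}) \<inter> {x. enorm k x \<le> B}"
      by (auto simp: cball_Rn_def Rn_def)
    moreover have "closed {x :: nat \<Rightarrow> real. x i = 0}" for i
      by (intro closed_Collect_eq continuous_on_product_coordinates continuous_on_const)
    moreover have "closed {x. enorm k x \<le> B}"
      by (intro closed_Collect_le cont continuous_on_const)
    ultimately show ?thesis by (simp add: closed_INT closed_Int)
  qed
  have sub: "cball_Rn k B \<subseteq> PiE UNIV (\<lambda>_. {-B..B})"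
  proof
    fix x assume x: "x \<in> cball_Rn k B"
    have "\<bar>x i\<bar> \<le> B" for i
    proof (cases "i < k")
      case True
      then have "\<bar>x i\<bar> \<le> L2_set (\<lambda>i. \<bar>x i\<bar>) {..<k}"
        by (intro member_le_L2_set) auto
      also have "\<dots> = enorm k x" by (simp add: enorm_def L2_set_def)
      finally show ?thesis using x by (simp add: cball_Rn_def)
    next
      case False
      \<comment> \<open>A negative \<open>B\<close> would make the ball empty, so the member
        \<open>x\<close> itself yields \<open>0 \<le> B\<close>.\<close>
      moreover have "0 \<le> B" using x order_trans[OF L2_set_nonneg] by (auto simp: cball_Rn_def enorm_def)
      ultimately show ?thesis using x by (simp add: cball_Rn_def Rn_def)
    qed
    then show "x \<in> PiE UNIV (\<lambda>_. {-B..B})" by (auto simp: abs_le_iff minus_le_iff)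
  qed
  have "compact (PiE UNIV (\<lambda>_. {-B..B}) \<inter> cball_Rn k B)" by (rule compact_Int_closed[OF K closed])
  then show ?thesis using sub by (simp add: Int_absorb1)
qed

section \<open>Euclidean norm and operator norm\<close>

lemma enorm_nonneg [simp]: "0 \<le> enorm k x"
  by (simp add: enorm_def)

lemma enorm_le_sum_abs: "enorm k x \<le> (\<Sum>i<k. \<bar>x i\<bar>)"
  unfolding enorm_def by (rule L2_set_le_sum_abs)

lemma abs_le_enorm: "i < k \<Longrightarrow> \<bar>x i\<bar> \<le> enorm k x"
  using member_le_L2_set[of "{..<k}" i "\<lambda>i. \<bar>x i\<bar>"] by (simp add: enorm_def L2_set_def)

lemma enorm_scale: "enorm k (\<lambda>i. c * x i) = \<bar>c\<bar> * enorm k x"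
  using L2_set_right_distrib[of "\<bar>c\<bar>" x "{..<k}"]
  by (simp add: enorm_def L2_set_def power_mult_distrib)

lemma enorm_add_le: "enorm k (\<lambda>i. x i + y i) \<le> enorm k x + enorm k y"
  unfolding enorm_def by (rule L2_set_triangle_ineq)

lemma enorm_diff_le: "enorm k (\<lambda>i. x i - y i) \<le> enorm k x + enorm k y"
  using enorm_add_le[of k x "\<lambda>i. (-1) * y i"] enorm_scale[of k "-1" y] by simp

lemma sum_mult_le_enorm: "(\<Sum>i<k. x i * y i) \<le> enorm k x * enorm k y"
proof -
  have "(\<Sum>i<k. x i * y i) \<le> (\<Sum>i<k. \<bar>x i\<bar> * \<bar>y i\<bar>)"
    by (intro sum_mono) (metis abs_ge_self abs_mult)
  also have "\<dots> \<le> enorm k x * enorm k y" unfolding enorm_def by (rule L2_set_mult_ineq)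
  finally show ?thesis .
qed

lemma segment_in_cball_Rn:
  assumes "\<theta> \<in> cball_Rn k B" "\<theta>' \<in> cball_Rn k B" "0 \<le> s" "s \<le> 1"
  shows "(\<lambda>i. \<theta> i + s * (\<theta>' i - \<theta> i)) \<in> cball_Rn k B"
proof -
  have "enorm k (\<lambda>i. \<theta> i + s * (\<theta>' i - \<theta> i)) = enorm k (\<lambda>i. (1 - s) * \<theta> i + s * \<theta>' i)"
    by (simp add: algebra_simps)
  also have "\<dots> \<le> (1 - s) * enorm k \<theta> + s * enorm k \<theta>'"
    using enorm_add_le[of k "\<lambda>i. (1 - s) * \<theta> i" "\<lambda>i. s * \<theta>' i"] assms by (simp add: enorm_scale)
  also have "\<dots> \<le> (1 - s) * B + s * B"
    using assms by (intro add_mono mult_left_mono) (auto simp: cball_Rn_def)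
  finally show ?thesis using assms by (simp add: cball_Rn_def Rn_def algebra_simps)
qed

text \<open>Crude in size, but continuous in the entries of \<open>A\<close>: it shows that the
  supremum defining \<open>opnorm\<close> is over a bounded set, and later bounds the operator norms
  of a continuous family of matrices over a compact set.\<close>

lemma enorm_matrix_le_sum_abs:
  assumes "v \<in> cball_Rn n 1"
  shows "enorm m (\<lambda>i. \<Sum>j<n. A i j * v j) \<le> (\<Sum>i<m. \<Sum>j<n. \<bar>A i j\<bar>)"
proof -
  have "\<bar>\<Sum>j<n. A i j * v j\<bar> \<le> (\<Sum>j<n. \<bar>A i j\<bar>)" for i
  proof -
    have "\<bar>\<Sum>j<n. A i j * v j\<bar> \<le> (\<Sum>j<n. \<bar>A i j * v j\<bar>)" by (rule sum_abs)
    also have "\<dots> \<le> (\<Sum>j<n. \<bar>A i j\<bar>)"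
    proof (rule sum_mono)
      fix j assume "j \<in> {..<n}"
      then have "\<bar>v j\<bar> \<le> 1" using abs_le_enorm[of j n v] assms by (simp add: cball_Rn_def)
      then show "\<bar>A i j * v j\<bar> \<le> \<bar>A i j\<bar>" by (simp add: abs_mult mult_left_le)
    qed
    finally show ?thesis .
  qed
  then show ?thesis by (intro order_trans[OF enorm_le_sum_abs] sum_mono)
qed

lemma zero_in_cball_Rn: "0 \<le> r \<Longrightarrow> (\<lambda>_. 0) \<in> cball_Rn n r"
  by (simp add: cball_Rn_def Rn_def enorm_def L2_set_def)

lemma bdd_above_opnorm:
  "bdd_above ((\<lambda>v. enorm m (\<lambda>i. \<Sum>j<n. A i j * v j)) ` cball_Rn n 1)"
  by (rule bdd_aboveI2[OF enorm_matrix_le_sum_abs])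

lemma opnorm_le_sum_abs: "opnorm m n A \<le> (\<Sum>i<m. \<Sum>j<n. \<bar>A i j\<bar>)"
  unfolding opnorm_def
  using zero_in_cball_Rn[of 1 n] by (intro cSUP_least enorm_matrix_le_sum_abs) auto

lemma opnorm_nonneg: "0 \<le> opnorm m n A"
  unfolding opnorm_def
  by (rule cSUP_upper2[OF bdd_above_opnorm zero_in_cball_Rn]) auto

text \<open>Homogeneity reduces the claim to \<open>d\<close> scaled to norm 1, a competitor in the
  supremum. At norm 0 there is nothing to scale, but then all entries of \<open>d\<close> that enter
  the sums vanish.\<close>

lemma enorm_matrix_le_opnorm:
  assumes "d \<in> Rn n"
  shows "enorm m (\<lambda>i. \<Sum>j<n. A i j * d j) \<le> opnorm m n A * enorm n d"
proof (cases "enorm n d = 0")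
  case True
  then have "d j = 0" if "j < n" for j using abs_le_enorm[OF that, of d] by simp
  then show ?thesis using True by (simp add: enorm_def L2_set_def)
next
  case False
  define r where "r = enorm n d"
  have r: "r > 0" using False enorm_nonneg[of n d] unfolding r_def by linarith
  have v: "(\<lambda>j. inverse r * d j) \<in> cball_Rn n 1"
    using assms r by (simp only: cball_Rn_def mem_Collect_eq enorm_scale) (simp add: Rn_def r_def)
  have "enorm m (\<lambda>i. \<Sum>j<n. A i j * (inverse r * d j)) \<le> opnorm m n A"
    unfolding opnorm_def by (rule cSUP_upper[OF v bdd_above_opnorm])
  also have "(\<lambda>i. \<Sum>j<n. A i j * (inverse r * d j)) = (\<lambda>i. inverse r * (\<Sum>j<n. A i j * d j))"
    by (simp add: sum_distrib_left mult_ac)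
  finally show ?thesis using r unfolding enorm_scale by (simp add: field_simps r_def)
qed

section \<open>Differentiation along lines and the mean value inequality\<close>

lemma partial_mvt:
  assumes diff: "\<And>\<theta>. \<theta> \<in> Rn k \<Longrightarrow> (\<lambda>s. G (\<theta>(j := s))) field_differentiable at (\<theta> j)"
    and "\<theta> \<in> Rn k" "j < k"
  shows "\<exists>z. \<bar>z - \<theta> j\<bar> \<le> \<bar>b - \<theta> j\<bar> \<and>
    G (\<theta>(j := b)) - G \<theta> = (b - \<theta> j) * partial j G (\<theta>(j := z))"
proof -
  \<comment> \<open>Differentiability at an arbitrary \<open>u\<close> is the hypothesis at the
    updated point \<open>\<theta>(j := u)\<close>, whose \<open>j\<close>-th coordinate is
    \<open>u\<close>.\<close>
  have D: "((\<lambda>s. G (\<theta>(j := s))) has_real_derivative partial j G (\<theta>(j := u))) (at u)" for u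
    using diff[OF fun_upd_in_Rn[OF assms(2,3), of u]]
    by (simp add: field_differentiable_derivI partial_def)
  consider "\<theta> j < b" | "\<theta> j = b" | "b < \<theta> j" by linarith
  then show ?thesis
  proof cases
    case 1
    from MVT2[OF 1 D] obtain z where "\<theta> j < z" "z < b"
      "G (\<theta>(j := b)) - G (\<theta>(j := \<theta> j)) = (b - \<theta> j) * partial j G (\<theta>(j := z))" by blast
    then show ?thesis by (intro exI[of _ z]) auto
  next
    case 2
    then show ?thesis by (intro exI[of _ b]) auto
  next
    case 3
    from MVT2[OF 3 D] obtain z where "b < z" "z < \<theta> j"
      "G (\<theta>(j := \<theta> j)) - G (\<theta>(j := b)) = (\<theta> j - b) * partial j G (\<theta>(j := z))" by blast
    then show ?thesis by (intro exI[of _ z]) (auto simp: algebra_simps)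
  qed
qed

text \<open>The classical argument that continuous partial derivatives give the chain rule: go from
  \<open>\<theta>\<close> to \<open>\<theta> + e d\<close> one coordinate at a time, apply the mean
  value theorem on each leg, and let the intermediate points tend to
  \<open>\<theta>\<close>.\<close>

lemma directional_derivative_0:
  assumes diff: "\<And>j \<theta>. j < k \<Longrightarrow> \<theta> \<in> Rn k \<Longrightarrow> (\<lambda>s. G (\<theta>(j := s))) field_differentiable at (\<theta> j)"
    and cont: "\<And>j. j < k \<Longrightarrow> continuous_on (Rn k) (partial j G)"
    and \<theta>: "\<theta> \<in> Rn k" and d: "d \<in> Rn k"
  shows "((\<lambda>s. G (\<lambda>i. \<theta> i + s * d i)) has_real_derivative (\<Sum>j<k. partial j G \<theta> * d j)) (at 0)"
proof -
  \<comment> \<open>\<open>P j e\<close> is the point of this path at which the first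
    \<open>j\<close> coordinates have been moved.\<close>
  define P where "P j e = (\<lambda>i. if i < j then \<theta> i + e * d i else \<theta> i)" for j e
  have P_Rn: "P j e \<in> Rn k" for j e using \<theta> d by (auto simp: P_def Rn_def)
  have P_diag: "P j e j = \<theta> j" for j e by (simp add: P_def)
  have P_Suc: "P (Suc j) e = (P j e)(j := \<theta> j + e * d j)" for j e
    by (auto simp: P_def fun_eq_iff less_Suc_eq)
  have "\<exists>z. \<bar>z - \<theta> j\<bar> \<le> \<bar>e * d j\<bar> \<and>
      G (P (Suc j) e) - G (P j e) = e * d j * partial j G ((P j e)(j := z))" if "j < k" for j e
    using partial_mvt[OF diff[OF that] P_Rn that, of j e "\<theta> j + e * d j"] unfolding P_Suc P_diag add_diff_cancel_left' .
  \<comment> \<open>The guard \<open>j < k\<close> goes under the existential so that one total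
    function of \<open>j\<close> and \<open>e\<close> can be chosen.\<close>
  then have "\<forall>j e. \<exists>w. j < k \<longrightarrow> \<bar>w - \<theta> j\<bar> \<le> \<bar>e * d j\<bar> \<and>
      G (P (Suc j) e) - G (P j e) = e * d j * partial j G ((P j e)(j := w))"
    by blast
  then obtain z where "\<forall>j e. j < k \<longrightarrow> \<bar>z j e - \<theta> j\<bar> \<le> \<bar>e * d j\<bar> \<and>
      G (P (Suc j) e) - G (P j e) = e * d j * partial j G ((P j e)(j := z j e))"
    unfolding choice_iff by blast
  then have z: "\<And>j e. j < k \<Longrightarrow> \<bar>z j e - \<theta> j\<bar> \<le> \<bar>e * d j\<bar>"
      "\<And>j e. j < k \<Longrightarrow> G (P (Suc j) e) - G (P j e) = e * d j * partial j G ((P j e)(j := z j e))"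
    by blast+
  define Q where "Q j e = (P j e)(j := z j e)" for j e
  have Q_Rn: "Q j e \<in> Rn k" if "j < k" for j e
    unfolding Q_def by (rule fun_upd_in_Rn[OF P_Rn that])
  \<comment> \<open>In coordinate \<open>i\<close>, \<open>Q j e\<close> lies within
    \<open>\<bar>e * d i\<bar>\<close> of \<open>\<theta>\<close>: the coordinate has been moved in
    full, not at all, or, for \<open>i = j\<close>, to the mean value point.\<close>
  have Q_lim: "(Q j \<longlongrightarrow> \<theta>) (at 0)" if "j < k" for j
  proof (rule tendsto_fun_componentwise, rule LIM_zero_cancel)
    fix i
    have "\<bar>Q j e i - \<theta> i\<bar> \<le> \<bar>e * d i\<bar>" for e
      using z(1)[OF that, of e] by (auto simp: Q_def P_def)
    moreover have "((\<lambda>e. \<bar>e * d i\<bar>) \<longlongrightarrow> 0) (at 0)"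
      by (rule tendsto_eq_intros refl | simp)+
    ultimately show "((\<lambda>e. Q j e i - \<theta> i) \<longlongrightarrow> 0) (at 0)"
      by (auto intro: Lim_null_comparison[where g = "\<lambda>e. \<bar>e * d i\<bar>", OF always_eventually])
  qed
  have quot: "(G (\<lambda>i. \<theta> i + (0 + e) * d i) - G (\<lambda>i. \<theta> i + 0 * d i)) / e = (\<Sum>j<k. partial j G (Q j e) * d j)"
    if "e \<noteq> 0" for e
  proof -
    have "P k e = (\<lambda>i. \<theta> i + (0 + e) * d i)" "P 0 e = (\<lambda>i. \<theta> i + 0 * d i)"
      using d by (auto simp: P_def Rn_def fun_eq_iff)
    then have "G (\<lambda>i. \<theta> i + (0 + e) * d i) - G (\<lambda>i. \<theta> i + 0 * d i) = (\<Sum>j<k. G (P (Suc j) e) - G (P j e))"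
      using sum_lessThan_telescope[of "\<lambda>j. G (P j e)" k] by simp
    also have "\<dots> = (\<Sum>j<k. e * (partial j G (Q j e) * d j))"
      by (intro sum.cong) (auto simp: z(2) Q_def mult_ac)
    also have "\<dots> = e * (\<Sum>j<k. partial j G (Q j e) * d j)" by (simp only: sum_distrib_left)
    finally show ?thesis using that by simp
  qed
  have "((\<lambda>e. \<Sum>j<k. partial j G (Q j e) * d j) \<longlongrightarrow> (\<Sum>j<k. partial j G \<theta> * d j)) (at 0)"
  proof (intro tendsto_sum tendsto_mult tendsto_const)
    fix j assume "j \<in> {..<k}"
    then have j: "j < k" by simp
    show "((\<lambda>e. partial j G (Q j e)) \<longlongrightarrow> partial j G \<theta>) (at 0)"
      by (rule continuous_on_tendsto_compose[OF cont[OF j] Q_lim[OF j] \<theta>]) (simp add: Q_Rn[OF j])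
  qed
  then show ?thesis
    unfolding DERIV_def
    by (rule Lim_transform_eventually) (use quot in \<open>auto simp: eventually_at_filter\<close>)
qed

lemma directional_derivative:
  assumes diff: "\<And>j \<theta>. j < k \<Longrightarrow> \<theta> \<in> Rn k \<Longrightarrow> (\<lambda>s. G (\<theta>(j := s))) field_differentiable at (\<theta> j)"
    and cont: "\<And>j. j < k \<Longrightarrow> continuous_on (Rn k) (partial j G)"
    and \<theta>: "\<theta> \<in> Rn k" and d: "d \<in> Rn k"
  shows "((\<lambda>s. G (\<lambda>i. \<theta> i + s * d i)) has_real_derivative
    (\<Sum>j<k. partial j G (\<lambda>i. \<theta> i + t * d i) * d j)) (at t)"
proof -
  have "(\<lambda>i. \<theta> i + t * d i) \<in> Rn k" using \<theta> d by (simp add: Rn_def)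
  from directional_derivative_0[OF diff cont this d]
  have "((\<lambda>s. G (\<lambda>i. \<theta> i + (s + t) * d i)) has_real_derivative
    (\<Sum>j<k. partial j G (\<lambda>i. \<theta> i + t * d i) * d j)) (at 0)"
    by (simp add: algebra_simps)
  then show ?thesis using DERIV_shift[of "\<lambda>s. G (\<lambda>i. \<theta> i + s * d i)" _ 0 t] by simp
qed

text \<open>A vector-valued map has no mean value equality. Pairing \<open>G\<close> with the fixed
  increment \<open>u\<close> gives a scalar function on the segment, to which the mean value theorem
  applies; Cauchy-Schwarz and division by the norm of \<open>u\<close> finish the argument. The
  segment stays in the ball by convexity.\<close>

lemma mean_value_inequality_cball_Rn:
  fixes G :: "nat \<Rightarrow> (nat \<Rightarrow> real) \<Rightarrow> real"
  assumes diff: "\<And>i j \<theta>. i < m \<Longrightarrow> j < k \<Longrightarrow> \<theta> \<in> Rn k \<Longrightarrow> (\<lambda>s. G i (\<theta>(j := s))) field_differentiable at (\<theta> j)"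
    and cont: "\<And>i j. i < m \<Longrightarrow> j < k \<Longrightarrow> continuous_on (Rn k) (partial j (G i))"
    and \<theta>: "\<theta> \<in> cball_Rn k B" "\<theta>' \<in> cball_Rn k B"
    and bound: "\<And>\<zeta> d. \<zeta> \<in> cball_Rn k B \<Longrightarrow> d \<in> Rn k \<Longrightarrow>
      enorm m (\<lambda>i. \<Sum>j<k. partial j (G i) \<zeta> * d j) \<le> L * enorm k d"
  shows "enorm m (\<lambda>i. G i \<theta>' - G i \<theta>) \<le> L * enorm k (\<lambda>j. \<theta>' j - \<theta> j)"
proof -
  define d where "d = (\<lambda>j. \<theta>' j - \<theta> j)"
  define u where "u = (\<lambda>i. G i \<theta>' - G i \<theta>)"
  define seg where "seg s = (\<lambda>j. \<theta> j + s * d j)" for s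
  have Rn: "\<theta> \<in> Rn k" "d \<in> Rn k" using \<theta> by (auto simp: cball_Rn_def Rn_def d_def)
  have seg: "seg s \<in> cball_Rn k B" if "0 \<le> s" "s \<le> 1" for s
    unfolding seg_def d_def by (rule segment_in_cball_Rn[OF \<theta> that])
  have ends: "seg 0 = \<theta>" "seg 1 = \<theta>'" by (auto simp: seg_def d_def)
  have "((\<lambda>s. \<Sum>i<m. u i * G i (seg s)) has_real_derivative
      (\<Sum>i<m. u i * (\<Sum>j<k. partial j (G i) (seg t) * d j))) (at t)" for t
    unfolding seg_def
    by (intro DERIV_sum DERIV_cmult directional_derivative diff cont Rn) auto
  then obtain t where t: "0 < t" "t < 1"
    "(\<Sum>i<m. u i * G i (seg 1)) - (\<Sum>i<m. u i * G i (seg 0))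
      = (1 - 0) * (\<Sum>i<m. u i * (\<Sum>j<k. partial j (G i) (seg t) * d j))"
    using MVT2[of 0 1 "\<lambda>s. \<Sum>i<m. u i * G i (seg s)"
      "\<lambda>t. \<Sum>i<m. u i * (\<Sum>j<k. partial j (G i) (seg t) * d j)"] by auto
  have "(enorm m u)\<^sup>2 = (\<Sum>i<m. u i * u i)"
    by (simp add: enorm_def L2_set_def sum_nonneg power2_eq_square)
  also have "\<dots> = (\<Sum>i<m. u i * (\<Sum>j<k. partial j (G i) (seg t) * d j))"
    using t(3) unfolding ends by (simp add: u_def right_diff_distrib flip: sum_subtractf)
  also have "\<dots> \<le> enorm m u * enorm m (\<lambda>i. \<Sum>j<k. partial j (G i) (seg t) * d j)"
    by (rule sum_mult_le_enorm)
  also have "\<dots> \<le> enorm m u * (L * enorm k d)"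
    using t seg Rn by (intro mult_left_mono bound) auto
  finally have *: "enorm m u * enorm m u \<le> enorm m u * (L * enorm k d)" by (simp add: power2_eq_square)
  \<comment> \<open>\<open>L\<close> has no assumed sign, but \<open>bound\<close> dominates a norm
    by this product. The sign settles the case in which \<open>u\<close> has norm 0 and cannot be
    divided out.\<close>
  have "0 \<le> L * enorm k d"
    using order_trans[OF enorm_nonneg bound[OF \<theta>(1) Rn(2)]] .
  then have "enorm m u \<le> L * enorm k d"
    using * mult_le_cancel_left_pos[of "enorm m u"] enorm_nonneg[of m u] by (cases "enorm m u = 0") auto
  then show ?thesis by (simp add: u_def d_def)
qed

section \<open>Lipschitz dependence of the certificates and their gradients on the parameter\<close>

lemma continuous_on_fix_fst:
  assumes "continuous_on (A \<times> B) (\<lambda>(x, y). F x y)" "x \<in> A"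
  shows "continuous_on B (F x)"
proof -
  have "continuous_on B (Pair x)"
    by (rule continuous_on_Pair[OF continuous_on_const continuous_on_id])
  from continuous_on_compose2[OF assms(1) this] show ?thesis using assms(2) by auto
qed

lemma bdd_above_continuous_image:
  fixes F :: "'a::topological_space \<Rightarrow> real"
  assumes "compact K" "continuous_on K F"
  shows "bdd_above (F ` K)"
  by (intro bounded_imp_bdd_above compact_imp_bounded compact_continuous_image assms)

text \<open>A continuous dominating function takes the place of continuity of \<open>F\<close>, so
  that no continuity of \<open>opnorm\<close> has to be established.\<close>

lemma bdd_above_case_prodI:
  fixes F G :: "'a::topological_space \<Rightarrow> 'b::topological_space \<Rightarrow> real"
  assumes "compact K" "continuous_on K (\<lambda>(x, y). G x y)" "\<And>x y. F x y \<le> G x y"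
  shows "bdd_above ((\<lambda>(x, y). F x y) ` K)"
proof -
  obtain M where "\<And>z. z \<in> K \<Longrightarrow> (\<lambda>(x, y). G x y) z \<le> M"
    using bdd_above_continuous_image[OF assms(1,2)] unfolding bdd_above_def by blast
  then have "(\<lambda>(x, y). F x y) z \<le> M" if "z \<in> K" for z
    using order_trans[OF assms(3)] that by (cases z) fastforce
  then show ?thesis by (rule bdd_aboveI2)
qed

context
  fixes p k :: nat and g :: "(nat \<Rightarrow> real) \<Rightarrow> (nat \<Rightarrow> real) \<Rightarrow> real"
    and S :: "(nat \<Rightarrow> real) set" and B :: real
  assumes C2: "C2 p k g" and S: "compact S" "S \<subseteq> Rn p"
begin

lemma compact_parameter_domain: "compact (S \<times> cball_Rn k B)"
  by (intro compact_Times S compact_cball_Rn)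

lemma parameter_domain_subset: "S \<times> cball_Rn k B \<subseteq> Rn p \<times> Rn k"
  using S by (auto simp: cball_Rn_def)

lemma bdd_above_Lg: "bdd_above ((\<lambda>(x, \<theta>). enorm k (grad k (g x) \<theta>)) ` (S \<times> cball_Rn k B))"
proof (rule bdd_above_case_prodI[OF compact_parameter_domain])
  have "continuous_on (S \<times> cball_Rn k B) (\<lambda>(x, \<theta>). partial j (g x) \<theta>)" if "j < k" for j
    using C2 that by (intro continuous_on_subset[OF _ parameter_domain_subset]) (auto simp: C2_def C1_def)
  then show "continuous_on (S \<times> cball_Rn k B) (\<lambda>(x, \<theta>). \<Sum>j<k. \<bar>partial j (g x) \<theta>\<bar>)"
    by (auto simp: case_prod_unfold intro!: continuous_intros)
  show "enorm k (grad k (g x) \<theta>) \<le> (\<Sum>j<k. \<bar>partial j (g x) \<theta>\<bar>)" for x \<theta>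
    using enorm_le_sum_abs[of k "grad k (g x) \<theta>"] by (simp add: grad_def)
qed

lemma bdd_above_Lgradg: "bdd_above ((\<lambda>(x, \<theta>). opnorm p k (mixed_hessian g x \<theta>)) ` (S \<times> cball_Rn k B))"
proof (rule bdd_above_case_prodI[OF compact_parameter_domain])
  have "continuous_on (S \<times> cball_Rn k B) (\<lambda>(x, \<theta>). mixed_hessian g x \<theta> i j)" if "i < p" "j < k" for i j
    unfolding mixed_hessian_def
    using C2 that by (intro continuous_on_subset[OF _ parameter_domain_subset]) (auto simp: C2_def C1_def)
  then show "continuous_on (S \<times> cball_Rn k B) (\<lambda>(x, \<theta>). \<Sum>i<p. \<Sum>j<k. \<bar>mixed_hessian g x \<theta> i j\<bar>)"
    by (auto simp: case_prod_unfold intro!: continuous_intros)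
qed (rule opnorm_le_sum_abs)

text \<open>The centre of the ball, paired with any point of \<open>S\<close>, is a competitor in
  the supremum. Nonemptiness matters because a real supremum over the empty set carries no
  information.\<close>

lemma Lg_nonneg:
  assumes "S \<noteq> {}" "0 \<le> B"
  shows "0 \<le> Lg k g S B"
proof -
  obtain x where "x \<in> S" using assms(1) by blast
  then have "(x, \<lambda>_. 0) \<in> S \<times> cball_Rn k B" using zero_in_cball_Rn[OF assms(2)] by simp
  then show ?thesis unfolding Lg_def by (rule cSUP_upper2[OF bdd_above_Lg]) simp
qed

lemma Lgradg_nonneg:
  assumes "S \<noteq> {}" "0 \<le> B"
  shows "0 \<le> Lgradg p k g S B"
proof -
  obtain x where "x \<in> S" using assms(1) by blast
  then have "(x, \<lambda>_. 0) \<in> S \<times> cball_Rn k B" using zero_in_cball_Rn[OF assms(2)] by simp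
  then show ?thesis unfolding Lgradg_def
    by (rule cSUP_upper2[OF bdd_above_Lgradg]) (simp add: opnorm_nonneg)
qed

text \<open>This is the mean value inequality with a single component, \<open>enorm 1\<close> being
  the absolute value; Cauchy-Schwarz bounds the directional derivatives of \<open>g x\<close> by the
  norm of its gradient in \<theta>.\<close>

lemma Lipschitz_Lg:
  assumes x: "x \<in> S" and \<theta>: "\<theta> \<in> cball_Rn k B" "\<theta>' \<in> cball_Rn k B"
  shows "\<bar>g x \<theta>' - g x \<theta>\<bar> \<le> Lg k g S B * enorm k (\<lambda>j. \<theta>' j - \<theta> j)"
proof -
  have "x \<in> Rn p" using x S by auto
  have "enorm 1 (\<lambda>i. g x \<theta>' - g x \<theta>) \<le> Lg k g S B * enorm k (\<lambda>j. \<theta>' j - \<theta> j)"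
  proof (rule mean_value_inequality_cball_Rn[OF _ _ \<theta>])
    show "(\<lambda>s. g x (\<theta>(j := s))) field_differentiable at (\<theta> j)" if "j < k" "\<theta> \<in> Rn k" for j \<theta>
      using C2 that \<open>x \<in> Rn p\<close> by (simp add: C2_def C1_def)
    show "continuous_on (Rn k) (partial j (g x))" if "j < k" for j
      by (rule continuous_on_fix_fst[OF _ \<open>x \<in> Rn p\<close>]) (use C2 that in \<open>simp add: C2_def C1_def\<close>)
    fix \<zeta> d assume \<zeta>: "\<zeta> \<in> cball_Rn k B" and "d \<in> Rn k"
    have le: "(\<Sum>j<k. partial j (g x) \<zeta> * e j) \<le> Lg k g S B * enorm k e" for e
    proof -
      have "(\<Sum>j<k. partial j (g x) \<zeta> * e j) = (\<Sum>j<k. grad k (g x) \<zeta> j * e j)"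
        by (simp add: grad_def)
      also have "\<dots> \<le> enorm k (grad k (g x) \<zeta>) * enorm k e" by (rule sum_mult_le_enorm)
      also have "enorm k (grad k (g x) \<zeta>) \<le> Lg k g S B"
        unfolding Lg_def using cSUP_upper[OF _ bdd_above_Lg, of "(x, \<zeta>)"] x \<zeta> by simp
      finally show ?thesis by (simp add: mult_right_mono)
    qed
    \<comment> \<open>The estimate \<open>le\<close> is one-sided; the directions \<open>d\<close>
      and \<open>- d\<close> together bound the absolute value.\<close>
    have "\<bar>\<Sum>j<k. partial j (g x) \<zeta> * d j\<bar> \<le> Lg k g S B * enorm k d"
      using le[of d] le[of "\<lambda>j. - 1 * d j"] enorm_scale[of k "-1" d] by (simp add: sum_negf)
    then show "enorm 1 (\<lambda>i. \<Sum>j<k. partial j (g x) \<zeta> * d j) \<le> Lg k g S B * enorm k d"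
      by (simp add: enorm_def lessThan_Suc)
  qed
  then show ?thesis by (simp add: enorm_def lessThan_Suc)
qed

text \<open>The map taking \<theta> to the gradient in \<open>x\<close> has
  \<open>mixed_hessian\<close> as its Jacobian, so operator norms bound its directional
  derivatives.\<close>

lemma Lipschitz_Lgradg:
  assumes x: "x \<in> S" and \<theta>: "\<theta> \<in> cball_Rn k B" "\<theta>' \<in> cball_Rn k B"
  shows "enorm p (\<lambda>i. grad p (\<lambda>y. g y \<theta>') x i - grad p (\<lambda>y. g y \<theta>) x i)
    \<le> Lgradg p k g S B * enorm k (\<lambda>j. \<theta>' j - \<theta> j)"
proof -
  have "x \<in> Rn p" using x S by auto
  have "enorm p (\<lambda>i. partial i (\<lambda>y. g y \<theta>') x - partial i (\<lambda>y. g y \<theta>) x)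
      \<le> Lgradg p k g S B * enorm k (\<lambda>j. \<theta>' j - \<theta> j)"
  proof (rule mean_value_inequality_cball_Rn[OF _ _ \<theta>, where G = "\<lambda>i \<theta>. partial i (\<lambda>y. g y \<theta>) x"])
    fix i assume "i < p"
    then have C1: "C1 p k (\<lambda>x \<theta>. partial i (\<lambda>y. g y \<theta>) x)" using C2 by (simp add: C2_def)
    show "(\<lambda>s. partial i (\<lambda>y. g y (\<theta>(j := s))) x) field_differentiable at (\<theta> j)" if "j < k" "\<theta> \<in> Rn k" for j \<theta>
      using C1 that \<open>x \<in> Rn p\<close> by (simp add: C1_def)
    show "continuous_on (Rn k) (partial j (\<lambda>\<theta>. partial i (\<lambda>y. g y \<theta>) x))" if "j < k" for j
      by (rule continuous_on_fix_fst[OF _ \<open>x \<in> Rn p\<close>]) (use C1 that in \<open>simp add: C1_def\<close>)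
  next
    fix \<zeta> d assume \<zeta>: "\<zeta> \<in> cball_Rn k B" and d: "d \<in> Rn k"
    have "enorm p (\<lambda>i. \<Sum>j<k. mixed_hessian g x \<zeta> i j * d j) \<le> opnorm p k (mixed_hessian g x \<zeta>) * enorm k d"
      by (rule enorm_matrix_le_opnorm[OF d])
    also have "opnorm p k (mixed_hessian g x \<zeta>) \<le> Lgradg p k g S B"
      unfolding Lgradg_def using cSUP_upper[OF _ bdd_above_Lgradg, of "(x, \<zeta>)"] x \<zeta> by simp
    finally show "enorm p (\<lambda>i. \<Sum>j<k. partial j (\<lambda>\<theta>. partial i (\<lambda>y. g y \<theta>) x) \<zeta> * d j)
        \<le> Lgradg p k g S B * enorm k d"
      by (simp add: mixed_hessian_def mult_right_mono)
  qed
  also have "enorm p (\<lambda>i. partial i (\<lambda>y. g y \<theta>') x - partial i (\<lambda>y. g y \<theta>) x)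
      = enorm p (\<lambda>i. grad p (\<lambda>y. g y \<theta>') x i - grad p (\<lambda>y. g y \<theta>) x i)"
    by (simp add: enorm_def L2_set_def grad_def)
  finally show ?thesis .
qed

end

section \<open>Independent samples and a union bound over finitely many cells\<close>

lemma (in prob_space) prob_all_samples_avoid_le:
  assumes E: "E \<in> sets M" and "\<epsilon> \<le> prob E"
  shows "measure (PiM {..<n} (\<lambda>_. M)) {\<xi> \<in> space (PiM {..<n} (\<lambda>_. M)). \<forall>i\<in>{..<n}. \<xi> i \<in> space M - E}
    \<le> exp (- (real n * \<epsilon>))"
proof -
  interpret P: product_prob_space "\<lambda>_. M" "{..<n}" ..
  have "emeasure (PiM {..<n} (\<lambda>_. M)) {\<xi> \<in> space (PiM {..<n} (\<lambda>_. M)). \<forall>i\<in>{..<n}. \<xi> i \<in> space M - E}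
      = (\<Prod>i<n. emeasure M (space M - E))"
    using E by (intro P.emeasure_PiM_Collect) auto
  also have "\<dots> = ennreal ((1 - prob E) ^ n)"
    by (simp add: emeasure_eq_measure prob_compl[OF E] ennreal_power)
  finally have "measure (PiM {..<n} (\<lambda>_. M)) {\<xi> \<in> space (PiM {..<n} (\<lambda>_. M)). \<forall>i\<in>{..<n}. \<xi> i \<in> space M - E}
      = (1 - prob E) ^ n"
    by (intro measure_eq_emeasure_eq_ennreal) auto
  also have "\<dots> \<le> exp (- \<epsilon>) ^ n"
    using assms(2) exp_ge_add_one_self[of "- \<epsilon>"] by (intro power_mono) auto
  also have "\<dots> = exp (- (real n * \<epsilon>))" by (simp flip: exp_of_nat_mult)
  finally show ?thesis .
qed

text \<open>A representative of error above \<epsilon> is fixed in each bad cell before sampling. A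
  solution in that cell forces every sample point to miss the error set of the representative. Hence
  only finitely many events have to be excluded, and the conclusion covers every data-dependent
  choice of \<theta>.\<close>

lemma (in prob_space) cellwise_generalization:
  fixes cell :: "'t \<Rightarrow> 'c" and E :: "'t \<Rightarrow> 'a set"
  assumes fin: "finite (cell ` \<Theta>)" and "0 \<le> \<epsilon>"
    and card: "real (card (cell ` \<Theta>)) * exp (- (real n * \<epsilon>)) \<le> \<delta>"
    and margin: "\<And>\<theta> \<theta>' x. \<theta> \<in> \<Theta> \<Longrightarrow> \<theta>' \<in> \<Theta> \<Longrightarrow> cell \<theta> = cell \<theta>' \<Longrightarrow> x \<in> space M \<Longrightarrow> Q \<theta> x \<Longrightarrow> x \<notin> E \<theta>'"
  shows "\<exists>A\<in>sets (PiM {..<n} (\<lambda>_. M)). measure (PiM {..<n} (\<lambda>_. M)) A \<ge> 1 - \<delta> \<and>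
    (\<forall>\<xi>\<in>A. \<forall>\<theta>\<in>\<Theta>. (\<forall>i<n. Q \<theta> (\<xi> i)) \<longrightarrow> prob (E \<theta>) \<le> \<epsilon>)"
proof -
  interpret P: product_prob_space "\<lambda>_. M" "{..<n}" ..
  let ?P = "PiM {..<n} (\<lambda>_. M)"
  define avoid where "avoid U = {\<xi> \<in> space ?P. \<forall>i\<in>{..<n}. \<xi> i \<in> space M - U}" for U
  have avoid_sets: "avoid U \<in> sets ?P" if [measurable]: "U \<in> sets M" for U
    unfolding avoid_def by measurable
  define bad where "bad = {c \<in> cell ` \<Theta>. \<exists>\<theta>\<in>\<Theta>. cell \<theta> = c \<and> prob (E \<theta>) > \<epsilon>}"
  have bad_fin: "finite bad" and bad_card: "card bad \<le> card (cell ` \<Theta>)"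
    using fin by (auto simp: bad_def intro: card_mono)
  have "\<forall>c\<in>bad. \<exists>\<theta>. \<theta> \<in> \<Theta> \<and> cell \<theta> = c \<and> prob (E \<theta>) > \<epsilon>" by (auto simp: bad_def)
  then obtain r where r: "\<And>c. c \<in> bad \<Longrightarrow> r c \<in> \<Theta> \<and> cell (r c) = c \<and> prob (E (r c)) > \<epsilon>"
    by metis
  \<comment> \<open>A non-measurable set has measure 0 in the library, so the representatives are measurable for free.\<close>
  have r_sets: "E (r c) \<in> sets M" if "c \<in> bad" for c
    using r[OF that] measure_notin_sets[of "E (r c)" M] \<open>0 \<le> \<epsilon>\<close> by force
  define A where "A = space ?P - (\<Union>c\<in>bad. avoid (E (r c)))"
  have U_sets: "(\<Union>c\<in>bad. avoid (E (r c))) \<in> sets ?P"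
    using bad_fin by (intro sets.finite_UN avoid_sets r_sets) auto
  have "measure ?P (\<Union>c\<in>bad. avoid (E (r c))) \<le> (\<Sum>c\<in>bad. measure ?P (avoid (E (r c))))"
    using bad_fin avoid_sets r_sets by (intro P.finite_measure_subadditive_finite) auto
  also have "\<dots> \<le> (\<Sum>c\<in>bad. exp (- (real n * \<epsilon>)))"
    unfolding avoid_def using r r_sets by (intro sum_mono prob_all_samples_avoid_le less_imp_le) auto
  also have "\<dots> \<le> real (card (cell ` \<Theta>)) * exp (- (real n * \<epsilon>))"
    using bad_card by (simp add: mult_right_mono)
  also note card
  finally have "measure ?P A \<ge> 1 - \<delta>"
    unfolding A_def using P.prob_compl[OF U_sets] by simp
  moreover have "A \<in> sets ?P" unfolding A_def using U_sets by auto
  moreover have "prob (E \<theta>) \<le> \<epsilon>" if "\<xi> \<in> A" "\<theta> \<in> \<Theta>" "\<forall>i<n. Q \<theta> (\<xi> i)" for \<xi> \<theta>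
  proof (rule ccontr)
    assume "\<not> prob (E \<theta>) \<le> \<epsilon>"
    then have c: "cell \<theta> \<in> bad" using that by (auto simp: bad_def)
    have "\<xi> i \<in> space M - E (r (cell \<theta>))" if "i < n" for i
    proof -
      have "\<xi> i \<in> space M" using \<open>\<xi> \<in> A\<close> that by (auto simp: A_def space_PiM)
      then show ?thesis
        using margin[of \<theta> "r (cell \<theta>)" "\<xi> i"] r[OF c] \<open>\<theta> \<in> \<Theta>\<close> \<open>\<forall>i<n. Q \<theta> (\<xi> i)\<close> that by auto
    qed
    then have "\<xi> \<in> avoid (E (r (cell \<theta>)))" using \<open>\<xi> \<in> A\<close> by (auto simp: avoid_def A_def)
    then show False using \<open>\<xi> \<in> A\<close> c by (auto simp: A_def)
  qed
  ultimately show ?thesis by blast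
qed

section \<open>Grid cells of the parameter ball and the logarithm of their number\<close>

lemma floor_div_eq_imp_close:
  fixes x y s :: real
  assumes "\<lfloor>x / s\<rfloor> = \<lfloor>y / s\<rfloor>" "s > 0"
  shows "\<bar>x - y\<bar> \<le> s"
proof -
  have "\<bar>x / s - y / s\<bar> \<le> 1" using assms(1) by linarith
  then have "\<bar>(x - y) / s\<bar> \<le> 1" by (simp add: diff_divide_distrib)
  then show ?thesis using assms(2) by (simp add: abs_divide)
qed

text \<open>The restriction to \<open>{..<k}\<close> makes a cell an extensional function, so that
  the cells meeting a ball lie in one finite \<open>PiE\<close>.\<close>

definition grid_cell :: "nat \<Rightarrow> real \<Rightarrow> (nat \<Rightarrow> real) \<Rightarrow> nat \<Rightarrow> int" where
  "grid_cell k s \<theta> = (\<lambda>i\<in>{..<k}. \<lfloor>\<theta> i / s\<rfloor>)"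

lemma enorm_diff_le_if_grid_cell_eq:
  assumes "grid_cell k s \<theta> = grid_cell k s \<theta>'" "s > 0"
  shows "enorm k (\<lambda>i. \<theta> i - \<theta>' i) \<le> s * sqrt (real k)"
proof -
  have "\<bar>\<theta> i - \<theta>' i\<bar> \<le> s" if "i < k" for i
    using fun_cong[OF assms(1), of i] assms(2) that
    by (intro floor_div_eq_imp_close) (auto simp: grid_cell_def)
  then have "L2_set (\<lambda>i. \<bar>\<theta> i - \<theta>' i\<bar>) {..<k} \<le> L2_set (\<lambda>_. s) {..<k}"
    by (intro L2_set_mono) auto
  then show ?thesis using assms(2) by (simp add: L2_set_constant mult.commute) (simp add: enorm_def L2_set_def)
qed

lemma grid_cell_image_cball_Rn:
  assumes s: "s > 0" and B: "B \<ge> 0"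
  shows "finite (grid_cell k s ` cball_Rn k B)"
    and "real (card (grid_cell k s ` cball_Rn k B)) \<le> (2 * B / s + 2) ^ k"
proof -
  let ?I = "{\<lfloor>- B / s\<rfloor>..\<lfloor>B / s\<rfloor>}"
  have sub: "grid_cell k s ` cball_Rn k B \<subseteq> PiE {..<k} (\<lambda>_. ?I)"
  proof
    fix c assume "c \<in> grid_cell k s ` cball_Rn k B"
    then obtain \<theta> where \<theta>: "\<theta> \<in> cball_Rn k B" "c = grid_cell k s \<theta>" by blast
    have "- B / s \<le> \<theta> i / s \<and> \<theta> i / s \<le> B / s" if "i < k" for i
    proof -
      have "\<bar>\<theta> i\<bar> \<le> B" using abs_le_enorm[OF that, of \<theta>] \<theta>(1) by (simp add: cball_Rn_def)
      then have "- B \<le> \<theta> i" "\<theta> i \<le> B" by linarith+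
      then show ?thesis using s by (auto intro!: divide_right_mono simp del: divide_minus_left)
    qed
    then show "c \<in> PiE {..<k} (\<lambda>_. ?I)"
      unfolding \<theta>(2) grid_cell_def by (auto intro!: floor_mono simp del: divide_minus_left)
  qed
  have fin: "finite (PiE {..<k} (\<lambda>_. ?I))" by (intro finite_PiE) auto
  show "finite (grid_cell k s ` cball_Rn k B)" by (rule finite_subset[OF sub fin])
  have "real (card (grid_cell k s ` cball_Rn k B)) \<le> real (card (PiE {..<k} (\<lambda>_. ?I)))"
    using card_mono[OF fin sub] by simp
  also have "\<dots> = real (card ?I) ^ k" by (simp add: card_PiE)
  also have "\<dots> \<le> (2 * B / s + 2) ^ k"
  proof (rule power_mono)
    \<comment> \<open>The count is
      \<open>\<lfloor>B / s\<rfloor> - \<lfloor>- B / s\<rfloor> + 1\<close>; rounding down at the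
      left end can cost one more unit, hence \<open>+ 2\<close>. The sign takes care of the
      truncation at 0 in the cardinality.\<close>
    have "B / s \<ge> 0" using s B by simp
    then show "real (card ?I) \<le> 2 * B / s + 2" by simp linarith
  qed simp
  finally show "real (card (grid_cell k s ` cball_Rn k B)) \<le> (2 * B / s + 2) ^ k" .
qed

text \<open>This is the positivity of \<open>ln (ln 4)\<close>, on which the universal constant and
  the sign of the confidence term rest.\<close>

lemma one_less_ln_4: "1 < ln (4::real)"
proof -
  have "exp (1::real) < 4" using exp_le by linarith
  then show ?thesis by (subst ln_exp[of 1, symmetric]) (simp only: ln_less_cancel_iff exp_gt_zero zero_less_numeral)
qed

lemma half_le_ln_2: "1 / 2 \<le> ln (2::real)"
proof -
  have "ln (4::real) = 2 * ln 2" using ln_realpow[of "2::real" 2] by simp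
  then show ?thesis using one_less_ln_4 by simp
qed

text \<open>The base is at most \<open>6 * R * sqrt k\<close>, with logarithm at most
  \<open>6 * R + ln k / 2\<close>. The hypothesis \<open>small\<close> bounds \<open>ln k\<close> by
  a multiple of \<open>ln n\<close>, and the lower bounds on \<open>R\<close> and
  \<open>ln n\<close> absorb both summands into \<open>R\<^sup>2 * (ln n) ^ 3\<close>.\<close>

lemma covering_exponent_bound:
  fixes R :: real and k n :: nat
  assumes R: "R > 1 / 2" and n: "n \<ge> 2" and small: "R\<^sup>2 * (real k * (ln n) ^ 3) < n"
  shows "(2 * (R * sqrt k) + 2) ^ k \<le> exp (144 * (R\<^sup>2 * (real k * (ln n) ^ 3)))"
proof (cases "k = 0")
  case False
  define l where "l = ln (real n)"
  have l: "l \<ge> 1 / 2"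
    using half_le_ln_2 n ln_le_cancel_iff[of 2 "real n"] unfolding l_def by linarith
  have l3: "l ^ 3 \<ge> 1 / 8" using power_mono[OF l, of 3] by (simp add: power_divide)
  have l3': "4 * l ^ 3 \<ge> l"
  proof -
    have "1 / 4 \<le> l ^ 2" using power_mono[OF l, of 2] by (simp add: power_divide)
    then have "l * 1 \<le> l * (4 * l ^ 2)" using l by (intro mult_left_mono) auto
    then show ?thesis by (simp add: power3_eq_cube power2_eq_square mult_ac)
  qed
  have R2: "R\<^sup>2 \<ge> 1 / 4" using power_mono[of "1/2" R 2] R by (simp add: power_divide)
  have R1: "R \<le> 2 * R\<^sup>2" using R mult_left_mono[of 1 "2 * R" R] by (simp add: power2_eq_square)
  \<comment> \<open>Since \<open>R\<^sup>2 \<ge> 1 / 4\<close> and \<open>l ^ 3 \<ge> 1 / 8\<close>,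
    smallness gives \<open>k < 32 n\<close>. As \<open>32 = 2 ^ 5 \<le> n ^ 5\<close>, this is at
    most \<open>n ^ 6\<close>.\<close>
  have "1 / 4 * (real k * (1 / 8)) \<le> R\<^sup>2 * (real k * l ^ 3)"
    using R2 l3 by (intro mult_mono) auto
  then have "real k < 32 * real n" using small unfolding l_def by simp
  also have "\<dots> \<le> real n ^ 6"
  proof -
    have "(2::real) ^ 5 \<le> real n ^ 5" using n by (intro power_mono) auto
    then have "32 * real n \<le> real n ^ 5 * real n" by (intro mult_right_mono) auto
    then show ?thesis by (simp flip: power_Suc2)
  qed
  finally have k: "real k < real n ^ 6" .
  have k1: "real k \<ge> 1" using False by simp
  have "ln (real k) \<le> ln (real n ^ 6)" using k k1 n by (intro ln_mono) auto
  then have lnk: "ln (real k) \<le> 6 * l" using n by (simp add: ln_realpow l_def)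
  have sk: "sqrt k \<ge> 1" using k1 by simp
  have "2 \<le> 4 * (R * sqrt k)" using mult_mono[of "1/2" R 1 "sqrt k"] R sk by simp
  then have "2 * (R * sqrt k) + 2 \<le> (6 * R) * sqrt k" by simp
  also have "\<dots> \<le> exp (6 * R) * exp (ln k / 2)"
  proof (rule mult_mono)
    show "6 * R \<le> exp (6 * R)" using exp_ge_add_one_self[of "6 * R"] by linarith
    have "exp (ln k / 2) ^ 2 = real k" using k1 by (simp flip: exp_of_nat_mult)
    then show "sqrt k \<le> exp (ln k / 2)" by (metis exp_ge_zero order_refl real_sqrt_abs abs_of_nonneg)
  qed auto
  also have "\<dots> = exp (6 * R + ln k / 2)" by (simp add: exp_add)
  \<comment> \<open>\<open>6 R \<le> 12 R\<^sup>2 \<le> 96 R\<^sup>2 l ^ 3\<close> and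
    \<open>ln k / 2 \<le> 3 l \<le> 48 R\<^sup>2 l ^ 3\<close>; the two constants add up to
    144.\<close>
  also have "6 * R + ln k / 2 \<le> 144 * (R\<^sup>2 * l ^ 3)"
  proof -
    have "R\<^sup>2 * (1 / 8) \<le> R\<^sup>2 * l ^ 3" using l3 by (intro mult_left_mono) auto
    moreover have "1 / 4 * l \<le> R\<^sup>2 * (4 * l ^ 3)" using l3' R2 l by (intro mult_mono) auto
    ultimately show ?thesis using R1 lnk by linarith
  qed
  finally have "2 * (R * sqrt k) + 2 \<le> exp (144 * (R\<^sup>2 * l ^ 3))" by simp
  then have "(2 * (R * sqrt k) + 2) ^ k \<le> exp (144 * (R\<^sup>2 * l ^ 3)) ^ k"
    using R by (intro power_mono) auto
  also have "\<dots> = exp (144 * (R\<^sup>2 * (real k * l ^ 3)))"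
    by (simp add: mult_ac flip: exp_of_nat_mult)
  finally show ?thesis by (simp add: l_def)
qed simp

section \<open>Generalization for a family that is Lipschitz in its parameter\<close>

lemma (in prob_space) Lipschitz_margin_generalization:
  fixes H :: "(nat \<Rightarrow> real) \<Rightarrow> 't \<Rightarrow> 'a \<Rightarrow> real" and k n :: nat and B L \<gamma> \<delta> W :: real
  defines "W \<equiv> (B * L / \<gamma>)\<^sup>2 * (real k * (ln n) ^ 3)"
  assumes lip: "\<And>\<theta> \<theta>' t x. \<theta> \<in> cball_Rn k B \<Longrightarrow> \<theta>' \<in> cball_Rn k B \<Longrightarrow> t \<in> T \<Longrightarrow> x \<in> space M \<Longrightarrow>
      \<bar>H \<theta>' t x - H \<theta> t x\<bar> \<le> L * enorm k (\<lambda>j. \<theta>' j - \<theta> j)"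
    and B: "0 < B" and L: "0 \<le> L" and \<gamma>: "0 < \<gamma>" and \<delta>: "0 < \<delta>" "\<delta> < 1"
    and n: "n \<ge> 2" and small: "W < n"
  shows "\<exists>A\<in>sets (PiM {..<n} (\<lambda>_. M)). measure (PiM {..<n} (\<lambda>_. M)) A \<ge> 1 - \<delta> \<and>
    (\<forall>\<xi>\<in>A. \<forall>\<theta>\<in>cball_Rn k B. (\<forall>i<n. \<forall>t\<in>T. H \<theta> t (\<xi> i) \<le> - \<gamma>) \<longrightarrow>
      prob {x \<in> space M. (SUP t\<in>T. ereal (H \<theta> t x)) > 0} \<le> (144 * W + ln (1 / \<delta>)) / n)"
proof -
  define R where "R = B * L / \<gamma>"
  have W: "W \<ge> 0" using n by (simp add: W_def)
  have "\<exists>cell :: (nat \<Rightarrow> real) \<Rightarrow> nat \<Rightarrow> int. finite (cell ` cball_Rn k B) \<and>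
      real (card (cell ` cball_Rn k B)) \<le> exp (144 * W) \<and>
      (\<forall>\<theta>\<in>cball_Rn k B. \<forall>\<theta>'\<in>cball_Rn k B. cell \<theta> = cell \<theta>' \<longrightarrow> L * enorm k (\<lambda>j. \<theta>' j - \<theta> j) \<le> \<gamma>)"
  \<comment> \<open>Two points of the ball are at most \<open>2 * B\<close> apart, and
    \<open>L * (2 * B) \<le> \<gamma>\<close> means \<open>R \<le> 1 / 2\<close>: then the whole
    ball is one cell.\<close>
  proof (cases "R \<le> 1 / 2")
    case True
    have "L * enorm k (\<lambda>j. \<theta>' j - \<theta> j) \<le> \<gamma>" if "\<theta> \<in> cball_Rn k B" "\<theta>' \<in> cball_Rn k B" for \<theta> \<theta>'
    proof -
      have "enorm k (\<lambda>j. \<theta>' j - \<theta> j) \<le> B + B"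
        using that by (intro order_trans[OF enorm_diff_le] add_mono) (auto simp: cball_Rn_def)
      then have "L * enorm k (\<lambda>j. \<theta>' j - \<theta> j) \<le> L * (B + B)" using L by (rule mult_left_mono)
      also have "\<dots> \<le> \<gamma>" using True \<gamma> by (simp add: R_def field_simps)
      finally show ?thesis .
    qed
    moreover have "(\<lambda>_ :: nat \<Rightarrow> real. \<lambda>_ :: nat. 0 :: int) ` cball_Rn k B = {\<lambda>_. 0}"
      using zero_in_cball_Rn[of B k] B by auto
    ultimately show ?thesis using W by (intro exI[of _ "\<lambda>_ _. 0"]) simp
  next
    case False
    then have R: "R > 1 / 2" by simp
    then have Lpos: "L > 0" using L by (cases "L = 0") (auto simp: R_def)
    show ?thesis
    \<comment> \<open>For \<open>k = 0\<close> the ball is a single point, and the side length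
      chosen below would divide by 0.\<close>
    proof (cases "k = 0")
      case True
      have "enorm k x = 0" for x using True by (simp add: enorm_def)
      moreover have "cball_Rn k B = {\<lambda>_. 0}"
        using zero_in_cball_Rn[of B k] B True by (auto simp: cball_Rn_def Rn_def)
      ultimately show ?thesis using W \<gamma> by (intro exI[of _ "\<lambda>_ _. 0"]) simp
    next
      case False
      \<comment> \<open>A cube of side \<open>s\<close> has diameter
        \<open>s * sqrt k = \<gamma> / L\<close>, exactly the move that uses up the margin.\<close>
      define s where "s = \<gamma> / (L * sqrt k)"
      have s: "s > 0" using False Lpos \<gamma> by (simp add: s_def)
      have "2 * B / s = 2 * (R * sqrt k)" by (simp add: s_def R_def)
      then have "real (card (grid_cell k s ` cball_Rn k B)) \<le> (2 * (R * sqrt k) + 2) ^ k"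
        using grid_cell_image_cball_Rn(2)[OF s, of B k] B by simp
      also have "\<dots> \<le> exp (144 * W)"
        using covering_exponent_bound[OF R n] small by (simp add: W_def R_def)
      finally have "real (card (grid_cell k s ` cball_Rn k B)) \<le> exp (144 * W)" .
      moreover have "L * enorm k (\<lambda>j. \<theta>' j - \<theta> j) \<le> \<gamma>" if "grid_cell k s \<theta> = grid_cell k s \<theta>'" for \<theta> \<theta>'
      proof -
        have "L * enorm k (\<lambda>j. \<theta>' j - \<theta> j) \<le> L * (s * sqrt k)"
          using enorm_diff_le_if_grid_cell_eq[OF that[symmetric] s] L by (rule mult_left_mono)
        also have "\<dots> = \<gamma>" using False Lpos by (simp add: s_def)
        finally show ?thesis .
      qed
      ultimately show ?thesis
        using grid_cell_image_cball_Rn(1)[OF s, of B k] B by (intro exI[of _ "grid_cell k s"]) auto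
    qed
  qed
  then obtain cell :: "(nat \<Rightarrow> real) \<Rightarrow> nat \<Rightarrow> int" where fin: "finite (cell ` cball_Rn k B)"
    and card: "real (card (cell ` cball_Rn k B)) \<le> exp (144 * W)"
    and diam: "\<And>\<theta> \<theta>'. \<theta> \<in> cball_Rn k B \<Longrightarrow> \<theta>' \<in> cball_Rn k B \<Longrightarrow> cell \<theta> = cell \<theta>' \<Longrightarrow>
      L * enorm k (\<lambda>j. \<theta>' j - \<theta> j) \<le> \<gamma>"
    by blast
  show ?thesis
  proof (rule cellwise_generalization[OF fin, where Q = "\<lambda>\<theta> x. \<forall>t\<in>T. H \<theta> t x \<le> - \<gamma>"])
    show "0 \<le> (144 * W + ln (1 / \<delta>)) / n"
      using W \<delta> by (intro divide_nonneg_nonneg add_nonneg_nonneg) auto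
    \<comment> \<open>The error level is chosen so that its exponential is
      \<open>exp (- (144 * W)) * \<delta>\<close>: the first factor cancels the number of cells and
      \<delta> is left.\<close>
    have "- (real n * ((144 * W + ln (1 / \<delta>)) / n)) = - (144 * W) + ln \<delta>"
      using n \<delta> by (simp add: ln_div)
    then have exp_eq: "exp (- (real n * ((144 * W + ln (1 / \<delta>)) / n))) = exp (- (144 * W)) * \<delta>"
      using \<delta> by (simp only: exp_add exp_ln)
    have "real (card (cell ` cball_Rn k B)) * (exp (- (144 * W)) * \<delta>) \<le> exp (144 * W) * (exp (- (144 * W)) * \<delta>)"
      using \<delta> by (intro mult_right_mono card) auto
    also have "\<dots> = \<delta>" by (simp add: exp_minus)
    finally show "real (card (cell ` cball_Rn k B)) * exp (- (real n * ((144 * W + ln (1 / \<delta>)) / n))) \<le> \<delta>"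
      by (simp only: exp_eq)
  next
    fix \<theta> \<theta>' x
    assume *: "\<theta> \<in> cball_Rn k B" "\<theta>' \<in> cball_Rn k B" "cell \<theta> = cell \<theta>'" "x \<in> space M" "\<forall>t\<in>T. H \<theta> t x \<le> - \<gamma>"
    have "H \<theta>' t x \<le> 0" if "t \<in> T" for t
      using lip[OF *(1,2) that *(4)] diam[OF *(1-3)] *(5) that by fastforce
    then have "(SUP t\<in>T. ereal (H \<theta>' t x)) \<le> 0" by (intro SUP_least) auto
    then show "x \<notin> {x \<in> space M. (SUP t\<in>T. ereal (H \<theta>' t x)) > 0}" by auto
  qed
qed

section \<open>Application to certificates along the flow\<close>

lemma confidence_term_bound:
  fixes \<gamma> Bh \<delta> :: real
  assumes "0 < \<gamma>" "\<gamma> \<le> Bh" "0 < \<delta>" "\<delta> < 1"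
  shows "ln (ln 4) + ln (1 / \<delta>) \<le> ln (ln (4 * Bh / \<gamma>) / \<delta>)"
proof -
  \<comment> \<open>Here \<open>\<gamma> \<le> Bh\<close> enters. The positive surplus
    \<open>ln (ln 4)\<close> over \<open>ln (1 / \<delta>)\<close> is what later rules out
    \<open>n = 1\<close>.\<close>
  have "ln 4 \<le> ln (4 * Bh / \<gamma>)" using assms by (simp add: field_simps)
  then have "ln (ln 4) \<le> ln (ln (4 * Bh / \<gamma>))"
    using one_less_ln_4 by simp
  then show ?thesis using assms one_less_ln_4 \<open>ln 4 \<le> ln (4 * Bh / \<gamma>)\<close> by (simp add: ln_div)
qed

text \<open>Along a solution the velocity is \<open>f\<close> of the position, so the first two
  arguments of \<open>h\<close> do not depend on \<theta>. Only the value and the gradient move,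
  both inside the region where \<open>Lh\<close> is valid, and \<open>sqrt (a\<^sup>2 + b\<^sup>2)
  \<le> \<bar>a\<bar> + \<bar>b\<bar>\<close> turns the two Lipschitz constants into their
  sum.\<close>

lemma h_along_Lipschitz:
  assumes C2: "C2 p k g" and S: "compact S" "S \<subseteq> Rn p" and "0 \<le> B"
    and x: "\<phi> t \<xi> \<in> S" and \<phi>': "\<phi>' t \<xi> = f (\<phi> t \<xi>)"
    and BV: "\<forall>V\<in>cert_class k g B. \<forall>x\<in>S. \<bar>V x\<bar> \<le> BV"
    and BgradV: "\<forall>V\<in>cert_class k g B. \<forall>x\<in>S. enorm p (grad p V x) \<le> BgradV"
    and "Lh \<ge> 0"
    and Lh: "\<forall>x\<in>S. \<forall>v v' w w'. \<bar>v\<bar> \<le> BV \<and> \<bar>v'\<bar> \<le> BV \<and> w \<in> cball_Rn p BgradV \<and> w' \<in> cball_Rn p BgradV \<longrightarrow>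
         \<bar>h (x, f x, v, w) - h (x, f x, v', w')\<bar>
           \<le> Lh * sqrt ((v - v')\<^sup>2 + (enorm p (\<lambda>i. w i - w' i))\<^sup>2)"
    and \<theta>: "\<theta> \<in> cball_Rn k B" "\<theta>' \<in> cball_Rn k B"
  shows "\<bar>h_along p h \<phi> \<phi>' (\<lambda>x. g x \<theta>') t \<xi> - h_along p h \<phi> \<phi>' (\<lambda>x. g x \<theta>) t \<xi>\<bar>
    \<le> Lh * (Lg k g S B + Lgradg p k g S B) * enorm k (\<lambda>j. \<theta>' j - \<theta> j)"
proof -
  let ?x = "\<phi> t \<xi>" and ?V = "\<lambda>\<theta> x. g x \<theta>" and ?d = "enorm k (\<lambda>j. \<theta>' j - \<theta> j)"
  have V: "\<bar>?V \<theta> ?x\<bar> \<le> BV" "grad p (?V \<theta>) ?x \<in> cball_Rn p BgradV" if "\<theta> \<in> cball_Rn k B" for \<theta>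
    using BV BgradV x that by (auto simp: cert_class_def cball_Rn_def Rn_def grad_def)
  have v: "\<bar>?V \<theta>' ?x - ?V \<theta> ?x\<bar> \<le> Lg k g S B * ?d"
    by (rule Lipschitz_Lg[OF C2 S x \<theta>])
  have w: "enorm p (\<lambda>i. grad p (?V \<theta>') ?x i - grad p (?V \<theta>) ?x i) \<le> Lgradg p k g S B * ?d"
    by (rule Lipschitz_Lgradg[OF C2 S x \<theta>])
  have "\<bar>h (?x, f ?x, ?V \<theta>' ?x, grad p (?V \<theta>') ?x) - h (?x, f ?x, ?V \<theta> ?x, grad p (?V \<theta>) ?x)\<bar>
      \<le> Lh * sqrt ((?V \<theta>' ?x - ?V \<theta> ?x)\<^sup>2 + (enorm p (\<lambda>i. grad p (?V \<theta>') ?x i - grad p (?V \<theta>) ?x i))\<^sup>2)"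
    using Lh x V[OF \<theta>(1)] V[OF \<theta>(2)] by blast
  also have "\<dots> \<le> Lh * (\<bar>?V \<theta>' ?x - ?V \<theta> ?x\<bar> + \<bar>enorm p (\<lambda>i. grad p (?V \<theta>') ?x i - grad p (?V \<theta>) ?x i)\<bar>)"
    by (intro mult_left_mono sqrt_sum_squares_le_sum_abs \<open>Lh \<ge> 0\<close>)
  also have "\<dots> \<le> Lh * (Lg k g S B * ?d + Lgradg p k g S B * ?d)"
    using v w \<open>Lh \<ge> 0\<close> by (intro mult_left_mono add_mono) auto
  finally show ?thesis by (simp add: h_along_def \<phi>' algebra_simps)
qed

text \<open>If \<open>Bh < \<gamma>\<close>, no certificate is feasible, and a right-hand side of at
  least 1 bounds every probability. Outside these two cases \<open>\<gamma> \<le> Bh\<close> makes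
  the confidence term positive, and a right-hand side below 1 then forces \<open>n \<ge> 2\<close>
  and \<open>W < n\<close>, as the Lipschitz argument requires.\<close>

lemma generalization_bound:
  fixes C B\<theta> BV BgradV Bh Lh \<gamma> \<delta> :: real and k n p :: nat
  assumes C: "C \<ge> 144" "C * ln (ln 4) \<ge> 1"
    and T: "maximal_flow_interval p f X T"
    and sol: "\<forall>\<xi>\<in>X. ode_solution p f \<xi> T (\<lambda>t. \<phi> t \<xi>) (\<lambda>t. \<phi>' t \<xi>)"
    and D: "prob_space D" and sets_D: "sets D = sets (restrict_space borel X)"
    and C2: "C2 p k g" and B\<theta>: "B\<theta> > 0"
    and S: "compact S" "S \<subseteq> Rn p" and \<phi>_S: "\<forall>\<xi>\<in>X. \<forall>t\<in>T. \<phi> t \<xi> \<in> S"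
    and BV: "\<forall>V\<in>cert_class k g B\<theta>. \<forall>x\<in>S. \<bar>V x\<bar> \<le> BV"
    and BgradV: "\<forall>V\<in>cert_class k g B\<theta>. \<forall>x\<in>S. enorm p (grad p V x) \<le> BgradV"
    and Bh: "\<forall>x\<in>S. \<forall>v w. \<bar>v\<bar> \<le> BV \<and> w \<in> cball_Rn p BgradV \<longrightarrow> \<bar>h (x, f x, v, w)\<bar> \<le> Bh"
    and Lh0: "Lh \<ge> 0"
    and Lh: "\<forall>x\<in>S. \<forall>v v' w w'. \<bar>v\<bar> \<le> BV \<and> \<bar>v'\<bar> \<le> BV \<and> w \<in> cball_Rn p BgradV \<and> w' \<in> cball_Rn p BgradV \<longrightarrow>
         \<bar>h (x, f x, v, w) - h (x, f x, v', w')\<bar>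
           \<le> Lh * sqrt ((v - v')\<^sup>2 + (enorm p (\<lambda>i. w i - w' i))\<^sup>2)"
    and \<gamma>: "\<gamma> > 0" and \<delta>: "0 < \<delta>" "\<delta> < 1" and n: "n > 0"
  shows "\<exists>A\<in>sets (PiM {..<n} (\<lambda>_. D)). measure (PiM {..<n} (\<lambda>_. D)) A \<ge> 1 - \<delta> \<and>
        (\<forall>\<xi>\<in>A. \<forall>V\<in>cert_class k g B\<theta>.
           (\<forall>i<n. \<forall>t\<in>T. h_along p h \<phi> \<phi>' V t (\<xi> i) \<le> - \<gamma>) \<longrightarrow>
           err p h \<phi> \<phi>' T D V
             \<le> C * (B\<theta>\<^sup>2 * (Lg k g S B\<theta> + Lgradg p k g S B\<theta>)\<^sup>2 * Lh\<^sup>2 *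
                      (real k * (ln (real n)) ^ 3 / (\<gamma>\<^sup>2 * real n))
                    + ln (ln (4 * Bh / \<gamma>) / \<delta>) / real n))"
proof -
  have lnln4: "ln (ln 4) > (0::real)" using one_less_ln_4 by simp
  interpret prob_space D by fact
  have space_D: "space D = X" using sets_eq_imp_space_eq[OF sets_D] by (simp add: space_restrict_space)
  have T0: "0 \<in> T" using T by (simp add: maximal_flow_interval_def flow_interval_def)
  \<comment> \<open>A probability space is nonempty; hence so is \<open>S\<close>, which gives the
    suprema their sign.\<close>
  obtain \<xi>0 where \<xi>0: "\<xi>0 \<in> X" using not_empty space_D by blast
  have S_ne: "S \<noteq> {}" using \<phi>_S \<xi>0 T0 by blast
  interpret P: product_prob_space "\<lambda>_. D" "{..<n}" ..
  define L where "L = Lh * (Lg k g S B\<theta> + Lgradg p k g S B\<theta>)"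
  have L: "L \<ge> 0"
    using Lh0 Lg_nonneg[OF C2 S S_ne] Lgradg_nonneg[OF C2 S S_ne] B\<theta> by (simp add: L_def)
  define W where "W = (B\<theta> * L / \<gamma>)\<^sup>2 * (real k * (ln n) ^ 3)"
  define conf where "conf = ln (ln (4 * Bh / \<gamma>) / \<delta>)"
  let ?rhs = "C * (B\<theta>\<^sup>2 * (Lg k g S B\<theta> + Lgradg p k g S B\<theta>)\<^sup>2 * Lh\<^sup>2 *
                    (real k * (ln (real n)) ^ 3 / (\<gamma>\<^sup>2 * real n))
                  + ln (ln (4 * Bh / \<gamma>) / \<delta>) / real n)"
  have rhs: "?rhs = C * (W + conf) / n"
    unfolding W_def conf_def L_def power_mult_distrib power_divide
    using \<gamma> n by (simp add: field_simps)
  have W0: "W \<ge> 0" using n by (simp add: W_def)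
  have vel: "\<phi>' t \<xi> = f (\<phi> t \<xi>)" if "\<xi> \<in> X" "t \<in> T" for t \<xi>
    using sol that by (simp add: ode_solution_def)
  show ?thesis
  proof (cases "Bh < \<gamma> \<or> 1 \<le> ?rhs")
    case True
    have "err p h \<phi> \<phi>' T D V \<le> ?rhs"
      if \<xi>: "\<xi> \<in> space (PiM {..<n} (\<lambda>_. D))" and V: "V \<in> cert_class k g B\<theta>"
        and feas: "\<forall>i<n. \<forall>t\<in>T. h_along p h \<phi> \<phi>' V t (\<xi> i) \<le> - \<gamma>" for \<xi> V
    proof -
      \<comment> \<open>The first sample at time 0 exists because \<open>n > 0\<close> and
        \<open>0 \<in> T\<close>. Feasibility there gives \<open>\<gamma> \<le> Bh\<close>, which
        leaves only the alternative \<open>1 \<le> ?rhs\<close>.\<close>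
      let ?\<eta> = "\<xi> 0"
      have \<eta>: "?\<eta> \<in> X" using \<xi> n by (auto simp: space_PiM space_D)
      have x: "\<phi> 0 ?\<eta> \<in> S" using \<phi>_S \<eta> T0 by blast
      have "grad p V (\<phi> 0 ?\<eta>) \<in> cball_Rn p BgradV"
        using BgradV V x by (auto simp: cball_Rn_def Rn_def grad_def)
      then have "\<bar>h_along p h \<phi> \<phi>' V 0 ?\<eta>\<bar> \<le> Bh"
        using BV V x Bh by (simp add: h_along_def vel[OF \<eta> T0])
      moreover have "h_along p h \<phi> \<phi>' V 0 ?\<eta> \<le> - \<gamma>" using feas n T0 by blast
      ultimately have "1 \<le> ?rhs" using True by linarith
      then show ?thesis using prob_le_1 order_trans unfolding err_def by blast
    qed
    then show ?thesis using prob_space.prob_space[OF prob_space_PiM[of "{..<n}" "\<lambda>_. D"]] D \<delta> by (intro bexI[of _ "space (PiM {..<n} (\<lambda>_. D))"]) auto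
  next
    case False
    then have "C * (W + conf) / n < 1" "\<gamma> \<le> Bh" using rhs by auto
    then have lt: "C * (W + conf) < n" using n by simp
    have conf: "ln (ln 4) + ln (1 / \<delta>) \<le> conf"
      unfolding conf_def using \<gamma> \<open>\<gamma> \<le> Bh\<close> \<delta> by (rule confidence_term_bound)
    have ln\<delta>: "ln (1 / \<delta>) \<ge> 0" using \<delta> by simp
    \<comment> \<open>The right-hand side is thus at least \<open>1 / n\<close>, so for
      \<open>n = 1\<close> it would not be below 1.\<close>
    have "1 \<le> C * ln (ln 4)" by (rule C(2))
    also have "\<dots> \<le> C * (W + conf)" using W0 conf ln\<delta> C by (intro mult_left_mono) auto
    finally have n2: "n \<ge> 2" using lt by linarith
    have conf0: "conf \<ge> 0" using conf ln\<delta> lnln4 by linarith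
    have "1 * W \<le> C * (W + conf)" using W0 conf0 C by (intro mult_mono) auto
    then have small: "W < n" using lt by linarith
    have "ln (1 / \<delta>) \<le> 144 * conf" using conf conf0 lnln4 by linarith
    then have "144 * W + ln (1 / \<delta>) \<le> 144 * (W + conf)" by (simp add: distrib_left)
    also have "\<dots> \<le> C * (W + conf)" using W0 conf0 C by (intro mult_right_mono) auto
    finally have le: "(144 * W + ln (1 / \<delta>)) / n \<le> ?rhs"
      unfolding rhs by (rule divide_right_mono) simp
    have "\<exists>A\<in>sets (PiM {..<n} (\<lambda>_. D)). measure (PiM {..<n} (\<lambda>_. D)) A \<ge> 1 - \<delta> \<and>
      (\<forall>\<xi>\<in>A. \<forall>\<theta>\<in>cball_Rn k B\<theta>. (\<forall>i<n. \<forall>t\<in>T. h_along p h \<phi> \<phi>' (\<lambda>x. g x \<theta>) t (\<xi> i) \<le> - \<gamma>) \<longrightarrow>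
        prob {\<xi> \<in> space D. (SUP t\<in>T. ereal (h_along p h \<phi> \<phi>' (\<lambda>x. g x \<theta>) t \<xi>)) > 0}
          \<le> (144 * W + ln (1 / \<delta>)) / n)"
      unfolding W_def
    proof (rule Lipschitz_margin_generalization[OF _ B\<theta> L \<gamma> \<delta> n2 small[unfolded W_def]])
      fix \<theta> \<theta>' t \<xi>
      assume \<theta>: "\<theta> \<in> cball_Rn k B\<theta>" "\<theta>' \<in> cball_Rn k B\<theta>" and "t \<in> T" "\<xi> \<in> space D"
      then have t: "\<phi> t \<xi> \<in> S" "\<phi>' t \<xi> = f (\<phi> t \<xi>)" using \<phi>_S vel by (auto simp: space_D)
      show "\<bar>h_along p h \<phi> \<phi>' (\<lambda>x. g x \<theta>') t \<xi> - h_along p h \<phi> \<phi>' (\<lambda>x. g x \<theta>) t \<xi>\<bar>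
        \<le> L * enorm k (\<lambda>j. \<theta>' j - \<theta> j)"
        unfolding L_def
        by (rule h_along_Lipschitz[where \<phi> = \<phi> and \<phi>' = \<phi>' and t = t and \<xi> = \<xi> and f = f, OF C2 S less_imp_le[OF B\<theta>] t BV BgradV Lh0 Lh \<theta>])
    qed
    then show ?thesis
      using le unfolding cert_class_def err_def by (blast intro: order_trans)
  qed
qed

theorem theorem4p2:
  "\<exists>C::real. C > 0 \<and>
    (\<forall>(p::nat) (k::nat)
      (f :: (nat \<Rightarrow> real) \<Rightarrow> nat \<Rightarrow> real)
      (X :: (nat \<Rightarrow> real) set) (T :: real set)
      (\<phi> :: real \<Rightarrow> (nat \<Rightarrow> real) \<Rightarrow> nat \<Rightarrow> real)
      (\<phi>' :: real \<Rightarrow> (nat \<Rightarrow> real) \<Rightarrow> nat \<Rightarrow> real)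
      (D :: (nat \<Rightarrow> real) measure)
      (h :: (nat \<Rightarrow> real) \<times> (nat \<Rightarrow> real) \<times> real \<times> (nat \<Rightarrow> real) \<Rightarrow> real)
      (g :: (nat \<Rightarrow> real) \<Rightarrow> (nat \<Rightarrow> real) \<Rightarrow> real)
      (S :: (nat \<Rightarrow> real) set)
      (B\<theta>::real) (BV::real) (BgradV::real) (Bh::real) (Lh::real)
      (\<gamma>::real) (\<delta>::real) (n::nat).
      continuous_on (Rn p) f \<and> f ` Rn p \<subseteq> Rn p \<and>
      compact X \<and> X \<subseteq> Rn p \<and>
      maximal_flow_interval p f X T \<and>
      (\<forall>\<xi>\<in>X. ode_solution p f \<xi> T (\<lambda>t. \<phi> t \<xi>) (\<lambda>t. \<phi>' t \<xi>)) \<and>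
      prob_space D \<and> sets D = sets (restrict_space borel X) \<and>
      continuous_on (Rn p \<times> Rn p \<times> UNIV \<times> Rn p) h \<and>
      C2 p k g \<and> B\<theta> > 0 \<and>
      compact S \<and> S \<subseteq> Rn p \<and> (\<forall>\<xi>\<in>X. \<forall>t\<in>T. \<phi> t \<xi> \<in> S) \<and>
      (\<forall>V\<in>cert_class k g B\<theta>. \<forall>x\<in>S. \<bar>V x\<bar> \<le> BV) \<and>
      (\<forall>V\<in>cert_class k g B\<theta>. \<forall>x\<in>S. enorm p (grad p V x) \<le> BgradV) \<and>
      (\<forall>x\<in>S. \<forall>v w. \<bar>v\<bar> \<le> BV \<and> w \<in> cball_Rn p BgradV \<longrightarrow> \<bar>h (x, f x, v, w)\<bar> \<le> Bh) \<and>
      Lh \<ge> 0 \<and>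
      (\<forall>x\<in>S. \<forall>v v' w w'. \<bar>v\<bar> \<le> BV \<and> \<bar>v'\<bar> \<le> BV \<and> w \<in> cball_Rn p BgradV \<and> w' \<in> cball_Rn p BgradV \<longrightarrow>
         \<bar>h (x, f x, v, w) - h (x, f x, v', w')\<bar>
           \<le> Lh * sqrt ((v - v')\<^sup>2 + (enorm p (\<lambda>i. w i - w' i))\<^sup>2)) \<and>
      \<gamma> > 0 \<and> 0 < \<delta> \<and> \<delta> < 1 \<and> n > 0
      \<longrightarrow>
      (\<exists>A\<in>sets (PiM {..<n} (\<lambda>_. D)). measure (PiM {..<n} (\<lambda>_. D)) A \<ge> 1 - \<delta> \<and>
        (\<forall>\<xi>\<in>A. \<forall>V\<in>cert_class k g B\<theta>.
           (\<forall>i<n. \<forall>t\<in>T. h_along p h \<phi> \<phi>' V t (\<xi> i) \<le> - \<gamma>) \<longrightarrow>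
           err p h \<phi> \<phi>' T D V
             \<le> C * (B\<theta>\<^sup>2 * (Lg k g S B\<theta> + Lgradg p k g S B\<theta>)\<^sup>2 * Lh\<^sup>2 *
                      (real k * (ln (real n)) ^ 3 / (\<gamma>\<^sup>2 * real n))
                    + ln (ln (4 * Bh / \<gamma>) / \<delta>) / real n))))"
proof -
  \<comment> \<open>144 is the covering exponent; the other summand makes
    \<open>C * ln (ln 4) \<ge> 1\<close>, so that the bound is trivial for a single sample.\<close>
  define C :: real where "C = 144 + 1 / ln (ln 4)"
  have "ln (ln 4) > (0::real)" using one_less_ln_4 by simp
  then have C: "C \<ge> 144" "C * ln (ln 4) \<ge> 1" by (auto simp: C_def algebra_simps)
  show ?thesis
    apply (intro exI[of _ C] conjI allI impI)
    subgoal using C(1) by simp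
    apply (elim conjE)
    apply (rule generalization_bound[OF C]; assumption)
    done
qed

end
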